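(* Let $\{x_k\}$ be the sequence of iterates generated by Algorithm DFN-LLA (applied to the perturbed objective $P$) when $\zeta_0>\bar\zeta=0$. Let $\bar x$ be any limit point of $\{x_k\}$, and let $K$ be an infinite set of indices such that $$\lim_{k\to\infty,\,k\in K}x_k=\bar x .$$ If the subsequence $\{d_k\}_{k\in K}$ of directions is dense in the unit sphere $S(0,1)$, then $\bar x$ is Clarke-Jahn stationary for the problem $\min_{x\in X}\bar F(x)$.
   Context: **Problem and standing assumptions.** Let $l,u\in\mathbb{R}^{n_x}$ and $X=\{x\in\mathbb{R}^{n_x}: l_i\le x_i\le u_i,\ i=1,\dots,n_x\}$. Let $F:\mathbb{R}^{n_x+n_y}\to\mathbb{R}$ (upper-level objective), $f:\mathbb{R}^{n_x+n_y}\to\mathbb{R}$ (lower-level objective), $\mathcal{Z}\subseteq\mathbb{R}^{n_y}$, and $\mathcal{R}(x)=\arg\min_{z\in\mathcal{Z}}f(x,z)$. Throughout, assume: there are mappings $y:\mathbb{R}^{n_x}\to\mathbb{R}^{n_y}$ and $\tilde y:\mathbb{R}^{n_x}\times\mathbb{R}\to\mathbb{R}^{n_y}$ such that for all $x\in X$, $\zeta>0$: (a) $y(x)\in\mathcal{R}(x)$; (b) $\|\tilde y(x,\zeta)-y(x)\|\le\zeta$. Put $\bar F(x)=F(x,y(x))$ and $P(x,\zeta)=F(x,\tilde y(x,\zeta))$. Assume also: (i) $F(x,y)$ is Lipschitz continuous with respect to $y$ with constant $L_F$; (ii) $\bar F$ is Lipschitz continuous with constant $L_{\bar F}$; (iii)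 there is $F_{low}>-\infty$ with $\bar F(x)\ge F_{low}$ for all $x\in X$. **Notation.** $\|\cdot\|$ is the Euclidean norm; $[x]_{[l,u]}=\max\{l,\min\{u,x\}\}$ (componentwise) is the projection onto $X$; $S(0,1)=\{x\in\mathbb{R}^{n_x}:\|x\|=1\}$. **Procedure ProjectedExtrapolation$(\tilde\alpha,x,d,\zeta)$**, with constants $\gamma>0$, $\hat\delta\in(0,1)$. Set $\alpha=\tilde\alpha$. If $P([x+\alpha d]_{[l,u]},\zeta)\le P(x,\zeta)-\gamma\alpha^2$, set $p^+=d$; else if $P([x-\alpha d]_{[l,u]},\zeta)\le P(x,\zeta)-\gamma\alpha^2$, set $p^+=-d$; else return $(0,d)$. Then loop: set $\beta=\alpha/\hat\delta$; if $P([x+\beta p^+]_{[l,u]},\zeta)>P(x,\zeta)-\gamma\beta^2$, return $(\alpha,p^+)$; otherwise set $\alpha=\beta$ and repeat the loop. **Algorithm DFN-LLA.** Input: $\theta\in(0,1)$, $\sigma\in(0,1)$, $\bar\zeta\ge0$, $x_0\in X$, directions $\{d_k\}\subset\mathbb{R}^{n_x}$ with $\|d_k\|=1$ for all $k$. Set $\alpha_{\min}=(\sigma\bar\zeta)^{1/3}$, choose $\zeta_0\ge\bar\zeta$ and $\tilde\alpha_0\ge\zeta_0^{1/3}$. For $k=0,1,2,\dots$: let $(\alpha_k,\tilde d_k)=$ ProjectedExtrapolation$(\tilde\alpha_k,x_k,d_k,\zeta_k)$. - If $\alpha_k=0$ (unsuccessful iteration): $\tilde\alpha_{k+1}=\max\{\alpha_{\min},\theta\tilde\alpha_k\}$,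 $x_{k+1}=x_k$; and $\zeta_{k+1}=\max\{\bar\zeta,\min\{\theta\zeta_k,\tilde\alpha_{k+1}^3\}\}$ if $\tilde\alpha_{k+1}^3<\zeta_k$, while $\zeta_{k+1}=\zeta_k$ otherwise. - If $\alpha_k>0$ (successful iteration): $\tilde\alpha_{k+1}=\alpha_k$, $\tilde x_k=[x_k+\alpha_k\tilde d_k]_{[l,u]}$, $\zeta_{k+1}=\zeta_k$, and $x_{k+1}$ is any point of $X$ with $P(x_{k+1},\zeta_k)\le P(\tilde x_k,\zeta_k)$. There is no stopping condition. **Density.** For an infinite index set $K$, $\{d_k\}_{k\in K}$ is dense in $S(0,1)$ if for any $\bar d\in S(0,1)$ and any $\varepsilon>0$ there is $k\in K$ with $\|d_k-\bar d\|\le\varepsilon$. **Stationarity.** The cone of feasible directions at $x\in X$ is $D(x)=\{d\in\mathbb{R}^{n_x}: d_i\ge0\text{ if }x_i=l_i,\ d_i\le0\text{ if }x_i=u_i,\ d_i\in\mathbb{R}\text{ otherwise}\}$. The Clarke-Jahn directional derivative is $$\bar F^{\circ}(\bar x,d)=\limsup_{x\to\bar x,\ t\downarrow0,\ x\in X,\ x+td\in X}\frac{\bar F(x+td)-\bar F(x)}{t}.$$ A point $x^*\in X$ is Clarke-Jahn stationary for $\min_{x\in X}\bar F(x)$ if $\bar F^{\circ}(x^*,d)\ge0$ for all $d\in D(x^* )$. *)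

theory Defs
  imports "HOL-Analysis.Analysis" "HOL-Library.While_Combinator"
begin

definition argmin_set :: "('a \<Rightarrow> real) \<Rightarrow> 'a set \<Rightarrow> 'a set" where
  "argmin_set g Z = {z. is_arg_min g (\<lambda>w. w \<in> Z) z}"

definition box_proj :: "real ^ 'n \<Rightarrow> real ^ 'n \<Rightarrow> real ^ 'n \<Rightarrow> real ^ 'n" where
  "box_proj l u x = (\<chi> i. max (l $ i) (min (u $ i) (x $ i)))"

text \<open>
  The expansion loop, with state \<open>\<alpha>\<close>: it goes on as long as the enlarged step
  \<open>\<beta> = \<alpha> / \<delta>\<close> still gives sufficient decrease. The value \<open>None\<close> means that it never stops.
\<close>

definition expand ::
  "real ^ 'n \<Rightarrow> real ^ 'n \<Rightarrow> (real ^ 'n \<Rightarrow> real \<Rightarrow> real) \<Rightarrow> real \<Rightarrow> real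
    \<Rightarrow> real \<Rightarrow> real ^ 'n \<Rightarrow> real ^ 'n \<Rightarrow> real \<Rightarrow> real option" where
  "expand l u P \<gamma> \<delta> \<alpha>0 x p \<zeta> =
     while_option
       (\<lambda>\<alpha>. P (box_proj l u (x + (\<alpha> / \<delta>) *\<^sub>R p)) \<zeta> \<le> P x \<zeta> - \<gamma> * (\<alpha> / \<delta>)\<^sup>2)
       (\<lambda>\<alpha>. \<alpha> / \<delta>) \<alpha>0"

definition projected_extrapolation ::
  "real ^ 'n \<Rightarrow> real ^ 'n \<Rightarrow> (real ^ 'n \<Rightarrow> real \<Rightarrow> real) \<Rightarrow> real \<Rightarrow> real
    \<Rightarrow> real \<Rightarrow> real ^ 'n \<Rightarrow> real ^ 'n \<Rightarrow> real \<Rightarrow> (real \<times> (real ^ 'n)) option" where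
  "projected_extrapolation l u P \<gamma> \<delta> \<alpha> x d \<zeta> =
     (if P (box_proj l u (x + \<alpha> *\<^sub>R d)) \<zeta> \<le> P x \<zeta> - \<gamma> * \<alpha>\<^sup>2
        then map_option (\<lambda>\<alpha>'. (\<alpha>', d)) (expand l u P \<gamma> \<delta> \<alpha> x d \<zeta>)
      else if P (box_proj l u (x - \<alpha> *\<^sub>R d)) \<zeta> \<le> P x \<zeta> - \<gamma> * \<alpha>\<^sup>2
        then map_option (\<lambda>\<alpha>'. (\<alpha>', - d)) (expand l u P \<gamma> \<delta> \<alpha> x (- d) \<zeta>)
      else Some (0, d))"

text \<open>
  One iteration, from \<open>(x, \<alpha>t, \<zeta>)\<close> to \<open>(x', \<alpha>t', \<zeta>')\<close>, where \<open>\<alpha>t\<close> is the tentative step size.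
  It is a relation because a successful iteration leaves a choice for \<open>x'\<close>.
\<close>

definition dfn_lla_step ::
  "real ^ 'n \<Rightarrow> real ^ 'n \<Rightarrow> (real ^ 'n \<Rightarrow> real \<Rightarrow> real) \<Rightarrow> real \<Rightarrow> real
    \<Rightarrow> real \<Rightarrow> real \<Rightarrow> real \<Rightarrow> real ^ 'n
    \<Rightarrow> real ^ 'n \<Rightarrow> real \<Rightarrow> real \<Rightarrow> real ^ 'n \<Rightarrow> real \<Rightarrow> real \<Rightarrow> bool" where
  "dfn_lla_step l u P \<gamma> \<delta> \<theta> \<sigma> \<zeta>bar d x \<alpha>t \<zeta> x' \<alpha>t' \<zeta>' \<longleftrightarrow>
     (\<exists>\<alpha> p. projected_extrapolation l u P \<gamma> \<delta> \<alpha>t x d \<zeta> = Some (\<alpha>, p) \<and>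
        (\<alpha> = 0 \<and>
           \<alpha>t' = max (root 3 (\<sigma> * \<zeta>bar)) (\<theta> * \<alpha>t) \<and>
           x' = x \<and>
           \<zeta>' = (if \<alpha>t' ^ 3 < \<zeta> then max \<zeta>bar (min (\<theta> * \<zeta>) (\<alpha>t' ^ 3)) else \<zeta>)
         \<or> \<alpha> > 0 \<and>
           \<alpha>t' = \<alpha> \<and>
           \<zeta>' = \<zeta> \<and>
           x' \<in> cbox l u \<and> P x' \<zeta> \<le> P (box_proj l u (x + \<alpha> *\<^sub>R p)) \<zeta>))"

definition dfn_lla_run ::
  "real ^ 'n \<Rightarrow> real ^ 'n \<Rightarrow> (real ^ 'n \<Rightarrow> real \<Rightarrow> real) \<Rightarrow> real \<Rightarrow> real
    \<Rightarrow> real \<Rightarrow> real \<Rightarrow> real \<Rightarrow> (nat \<Rightarrow> real ^ 'n)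
    \<Rightarrow> (nat \<Rightarrow> real ^ 'n) \<Rightarrow> (nat \<Rightarrow> real) \<Rightarrow> (nat \<Rightarrow> real) \<Rightarrow> bool" where
  "dfn_lla_run l u P \<gamma> \<delta> \<theta> \<sigma> \<zeta>bar d x \<alpha>t \<zeta> \<longleftrightarrow>
     (\<forall>k. norm (d k) = 1) \<and>
     x 0 \<in> cbox l u \<and> \<zeta> 0 \<ge> \<zeta>bar \<and> \<alpha>t 0 \<ge> root 3 (\<zeta> 0) \<and>
     (\<forall>k. dfn_lla_step l u P \<gamma> \<delta> \<theta> \<sigma> \<zeta>bar (d k)
            (x k) (\<alpha>t k) (\<zeta> k) (x (Suc k)) (\<alpha>t (Suc k)) (\<zeta> (Suc k)))"

text \<open>
  For an objective that is bounded below the procedure always returns, so \<open>dfn_lla_run\<close> does not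
  exclude any behaviour of the algorithm by requiring a result \<open>Some _\<close> in every iteration.
\<close>

lemma expand_returns:
  assumes "\<gamma> > 0" "0 < \<delta>" "\<delta> < 1" "\<alpha>0 > 0" and low: "\<And>w. m \<le> P (box_proj l u w) \<zeta>"
  shows "expand l u P \<gamma> \<delta> \<alpha>0 x p \<zeta> \<noteq> None"
proof -
  have it: "((\<lambda>\<alpha>. \<alpha> / \<delta>) ^^ k) \<alpha>0 = \<alpha>0 * (1 / \<delta>) ^ k" for k
    by (induction k) (auto simp: field_simps)
  define C where "C = max 1 ((P x \<zeta> - m) / \<gamma>)"
  have "1 < 1 / \<delta>" using assms by simp
  then obtain k where "(C + 1) / \<alpha>0 < (1 / \<delta>) ^ k" using real_arch_pow by blast
  then have k: "C + 1 < \<alpha>0 * (1 / \<delta>) ^ k" using assms by (simp add: field_simps)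
  have C1: "C \<ge> 1" by (simp add: C_def)
  let ?b = "\<alpha>0 * (1 / \<delta>) ^ k / \<delta>"
  have "\<alpha>0 * (1 / \<delta>) ^ k \<le> ?b" using assms by (simp add: field_simps)
  then have b: "C < ?b" using k by linarith
  then have "?b * 1 \<le> ?b * ?b" using C1 by (intro mult_left_mono) auto
  then have "C < ?b\<^sup>2" using b by (simp add: power2_eq_square)
  then have "(P x \<zeta> - m) / \<gamma> < ?b\<^sup>2" by (simp add: C_def)
  then have "P x \<zeta> - m < \<gamma> * ?b\<^sup>2" using assms(1) by (simp add: field_simps)
  then have "\<not> P (box_proj l u (x + ?b *\<^sub>R p)) \<zeta> \<le> P x \<zeta> - \<gamma> * ?b\<^sup>2"
    using low[of "x + ?b *\<^sub>R p"] by linarith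
  then show ?thesis unfolding expand_def while_option_def it by (auto simp del: not_le)
qed

lemma projected_extrapolation_returns:
  assumes "\<gamma> > 0" "0 < \<delta>" "\<delta> < 1" "\<alpha> > 0" "\<And>w. m \<le> P (box_proj l u w) \<zeta>"
  shows "projected_extrapolation l u P \<gamma> \<delta> \<alpha> x d \<zeta> \<noteq> None"
  using expand_returns[where P = P and l = l and u = u and \<zeta> = \<zeta>, OF assms] by (auto simp: projected_extrapolation_def)

definition feasible_dirs :: "real ^ 'n \<Rightarrow> real ^ 'n \<Rightarrow> real ^ 'n \<Rightarrow> (real ^ 'n) set" where
  "feasible_dirs l u x =
     {d. \<forall>i. (x $ i = l $ i \<longrightarrow> d $ i \<ge> 0) \<and> (x $ i = u $ i \<longrightarrow> d $ i \<le> 0)}"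

text \<open>The limit superior ranges over base points \<open>x\<close> near \<open>xbar\<close>, including \<open>xbar\<close> itself.\<close>

definition clarke_jahn_deriv ::
  "(real ^ 'n) set \<Rightarrow> (real ^ 'n \<Rightarrow> real) \<Rightarrow> real ^ 'n \<Rightarrow> real ^ 'n \<Rightarrow> ereal" where
  "clarke_jahn_deriv X G xbar d =
     Limsup (inf (nhds xbar \<times>\<^sub>F at_right 0) (principal {(x, t). x \<in> X \<and> x + t *\<^sub>R d \<in> X}))
       (\<lambda>(x, t). ereal ((G (x + t *\<^sub>R d) - G x) / t))"

definition clarke_jahn_stationary ::
  "real ^ 'n \<Rightarrow> real ^ 'n \<Rightarrow> (real ^ 'n \<Rightarrow> real) \<Rightarrow> real ^ 'n \<Rightarrow> bool" where
  "clarke_jahn_stationary l u G x \<longleftrightarrow>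
     x \<in> cbox l u \<and> (\<forall>d \<in> feasible_dirs l u x. clarke_jahn_deriv (cbox l u) G x d \<ge> 0)"

definition dense_in_unit_sphere :: "(nat \<Rightarrow> real ^ 'n) \<Rightarrow> nat set \<Rightarrow> bool" where
  "dense_in_unit_sphere d K \<longleftrightarrow>
     (\<forall>dbar \<in> sphere 0 1. \<forall>\<epsilon>>0. \<exists>k\<in>K. norm (d k - dbar) \<le> \<epsilon>)"

end

theory Submission
  imports Defs
begin

text \<open>
  Every iteration tests the direction \<open>d k\<close> from \<open>x k\<close>, and either \<open>d k\<close> fails to give sufficient
  decrease at the tentative step, or the expansion along it stops at an enlarged step that fails.
  A failure at step \<open>\<eta>\<close> says that \<open>P\<close> drops by less than \<open>\<gamma> * \<eta>\<^sup>2\<close>. The accuracy \<open>\<zeta> k\<close> never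
  exceeds \<open>\<alpha>t k ^ 3 \<le> \<eta> ^ 3\<close>, so passing from \<open>P\<close> to the exact function costs only
  \<open>O(\<eta> ^ 3)\<close>: the exact difference quotient along \<open>d k\<close> is at least \<open>- O(\<eta>)\<close>.

  The steps \<open>\<eta>\<close> tend to \<open>0\<close> because of a potential: the value of \<open>P\<close> plus a multiple of \<open>\<zeta> k\<close>
  plus \<open>\<gamma> / 2 * (\<alpha>t k)\<^sup>2\<close> is bounded below and drops in every iteration by at least a fixed
  multiple of \<open>(\<alpha>t k)\<^sup>2\<close> (\<open>potential_decrease\<close>). The term in \<open>\<zeta> k\<close> pays for the jumps of \<open>P\<close> when
  the accuracy changes; each change shrinks \<open>\<zeta>\<close> at least by the factor \<open>\<theta>\<close>, so these
  jumps are bounded by a multiple of the drop of \<open>\<zeta>\<close>.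

  Let now \<open>e\<close> be a feasible unit direction at the limit point. By density some \<open>d k\<close> with \<open>k \<in> K\<close>
  arbitrarily large is close to \<open>e\<close>. Close to the limit point a short step along \<open>e\<close> stays in the box,
  so the projection moves the trial point along \<open>d k\<close> away from the point along \<open>e\<close> by at most
  \<open>\<eta> * norm (d k - e)\<close>, and Lipschitz continuity gives an almost nonnegative difference quotient
  along \<open>e\<close> (\<open>ascent_of_failure\<close>).

  Dimension one is special: the unit sphere has two isolated points, so density does not make a
  direction recur, and it may be that \<open>d k = - e\<close> for all large \<open>k\<close>. Then either the direction \<open>e\<close>
  fails as before, or the algorithm finds a decrease along \<open>- e\<close>. In the second case the point reached
  serves as base point: going back from there to \<open>x k\<close> is a step along \<open>e\<close> that does not decrease the
  function (\<open>ascent_of_opposite_decrease\<close>).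
\<close>

section \<open>Projection onto a box and feasible directions\<close>

lemma box_proj_in_cbox:
  assumes "cbox l u \<noteq> {}"
  shows "box_proj l u w \<in> cbox l u"
proof -
  have "l $ i \<le> u $ i" for i
    using assms unfolding ex_in_conv[symmetric] mem_box_cart by (meson order_trans)
  then show ?thesis
    by (auto simp: box_proj_def mem_box_cart)
qed

lemma box_proj_id: "w \<in> cbox l u \<Longrightarrow> box_proj l u w = w"
  by (auto simp: box_proj_def mem_box_cart vec_eq_iff)

lemma box_proj_nonexpansive: "norm (box_proj l u v - box_proj l u w) \<le> norm (v - w)"
  by (rule norm_le_componentwise_cart) (auto simp: box_proj_def)

text \<open>
  The radius is half the smallest positive gap between a coordinate of \<open>xbar\<close> and a bound (half of \<open>1\<close>
  if there is no smaller gap). Bounds at distance less than this from \<open>z\<close> are active at \<open>xbar\<close>, and \<open>e\<close> does not point across them. Hence one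
  radius serves all base points \<open>z\<close>, which the moving base points of the Clarke-Jahn derivative
  require.
\<close>

lemma feasible_dirs_uniform_step:
  assumes "xbar \<in> cbox l u" "e \<in> feasible_dirs l u xbar" "norm e = 1"
  obtains \<rho> where "\<rho> > 0"
    and "\<And>z t. z \<in> cbox l u \<Longrightarrow> dist z xbar < \<rho> \<Longrightarrow> 0 \<le> t \<Longrightarrow> t < \<rho> \<Longrightarrow> z + t *\<^sub>R e \<in> cbox l u"
proof -
  define gaps where "gaps = (\<Union>i. {xbar $ i - l $ i, u $ i - xbar $ i}) \<inter> {0<..}"
  define m where "m = Min (insert 1 gaps)"
  have fin: "finite (insert 1 gaps)"
    unfolding gaps_def by auto
  have m: "m > 0"
    unfolding m_def using fin by (subst Min_gr_iff) (auto simp: gaps_def)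
  have gap: "m \<le> g" if "g \<in> gaps" for g
    unfolding m_def using that fin by auto
  have "z + t *\<^sub>R e \<in> cbox l u"
    if z: "z \<in> cbox l u" "dist z xbar < m / 2" and t: "0 \<le> t" "t < m / 2" for z t
  proof -
    have "l $ i \<le> z $ i + t * e $ i \<and> z $ i + t * e $ i \<le> u $ i" for i
    proof -
      have zi: "\<bar>z $ i - xbar $ i\<bar> < m / 2"
        using component_le_norm_cart[of "z - xbar" i] z(2) by (simp add: dist_norm)
      have "\<bar>e $ i\<bar> \<le> 1"
        using component_le_norm_cart[of e i] assms(3) by simp
      then have te: "\<bar>t * e $ i\<bar> \<le> t"
        using t(1) by (simp add: abs_mult mult_left_le)
      have bnd: "l $ i \<le> z $ i" "z $ i \<le> u $ i" "l $ i \<le> xbar $ i" "xbar $ i \<le> u $ i"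
        using z(1) assms(1) by (auto simp: mem_box_cart)
      have lower: "l $ i \<le> z $ i + t * e $ i"
      proof (cases "xbar $ i = l $ i")
        case True
        then have "t * e $ i \<ge> 0"
          using assms(2) t(1) by (auto simp: feasible_dirs_def)
        then show ?thesis using bnd by linarith
      next
        case False
        then have "m \<le> xbar $ i - l $ i"
          using bnd by (intro gap) (auto simp: gaps_def)
        then show ?thesis using zi te t by linarith
      qed
      have upper: "z $ i + t * e $ i \<le> u $ i"
      proof (cases "xbar $ i = u $ i")
        case True
        then have "t * e $ i \<le> 0"
          using assms(2) t(1) by (auto simp: feasible_dirs_def mult_nonneg_nonpos)
        then show ?thesis using bnd by linarith
      next
        case False
        then have "m \<le> u $ i - xbar $ i"
          using bnd by (intro gap) (auto simp: gaps_def)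
        then show ?thesis using zi te t by linarith
      qed
      show ?thesis using lower upper by blast
    qed
    then show ?thesis by (simp add: mem_box_cart)
  qed
  then show thesis
    using that[of "m / 2"] m by simp
qed

section \<open>Nonnegativity of the Clarke-Jahn derivative\<close>

text \<open>
  A limit superior is nonnegative as soon as almost nonnegative quotients occur frequently, and the base
  points are free to move: one good pair of base point and step in each neighbourhood is enough.
\<close>

lemma clarke_jahn_deriv_nonnegI:
  assumes ascent: "\<And>\<epsilon>. \<epsilon> > 0 \<Longrightarrow> \<exists>z t. z \<in> X \<and> dist z xbar < \<epsilon> \<and> 0 < t \<and> t < \<epsilon> \<and>
      z + t *\<^sub>R v \<in> X \<and> - \<epsilon> * t \<le> G (z + t *\<^sub>R v) - G z"
  shows "clarke_jahn_deriv X G xbar v \<ge> 0"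
proof (rule ccontr)
  let ?q = "\<lambda>(z, t). ereal ((G (z + t *\<^sub>R v) - G z) / t)"
  let ?F = "inf (nhds xbar \<times>\<^sub>F at_right 0) (principal {(x, t). x \<in> X \<and> x + t *\<^sub>R v \<in> X})"
  assume "\<not> clarke_jahn_deriv X G xbar v \<ge> 0"
  then have "Limsup ?F ?q < ereal 0"
    unfolding clarke_jahn_deriv_def by (simp add: zero_ereal_def)
  then obtain c where c: "Limsup ?F ?q < ereal c" "ereal c < ereal 0"
    using ereal_dense2 by blast
  have "\<forall>\<^sub>F p in ?F. ?q p < ereal c"
    using c(1) by (rule Limsup_lessD)
  then have "\<forall>\<^sub>F p in nhds xbar \<times>\<^sub>F at_right (0::real).
      p \<in> {(x, t). x \<in> X \<and> x + t *\<^sub>R v \<in> X} \<longrightarrow> ?q p < ereal c"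
    unfolding eventually_inf_principal .
  then obtain A B where A: "eventually A (nhds xbar)" and B: "eventually B (at_right (0::real))"
    and AB: "\<And>z t. A z \<Longrightarrow> B t \<Longrightarrow> z \<in> X \<Longrightarrow> z + t *\<^sub>R v \<in> X \<Longrightarrow> (G (z + t *\<^sub>R v) - G z) / t < c"
    unfolding eventually_prod_filter by auto
  obtain a where a: "a > 0" "\<And>z. dist z xbar < a \<Longrightarrow> A z"
    using A unfolding eventually_nhds_metric by blast
  obtain b where b: "b > 0" "\<And>t. 0 < t \<Longrightarrow> t < b \<Longrightarrow> B t"
    using B unfolding eventually_at_right_field by auto
  define \<epsilon> where "\<epsilon> = min (min a b) (- c)"
  have \<epsilon>: "\<epsilon> > 0" "\<epsilon> \<le> a" "\<epsilon> \<le> b" "\<epsilon> \<le> - c"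
    using a(1) b(1) c(2) by (auto simp: \<epsilon>_def)
  obtain z t where zt: "z \<in> X" "dist z xbar < \<epsilon>" "0 < t" "t < \<epsilon>" "z + t *\<^sub>R v \<in> X"
      "- \<epsilon> * t \<le> G (z + t *\<^sub>R v) - G z"
    using ascent[OF \<epsilon>(1)] by blast
  have "A z" "B t"
    using a(2) b(2) zt \<epsilon> by auto
  then have "(G (z + t *\<^sub>R v) - G z) / t < c"
    using AB zt by blast
  moreover have "- \<epsilon> \<le> (G (z + t *\<^sub>R v) - G z) / t"
    using zt(3,6) by (simp add: pos_le_divide_eq)
  ultimately show False
    using \<epsilon>(4) by linarith
qed

text \<open>
  Positive homogeneity in the direction: a step \<open>t\<close> along \<open>e\<close> is a step \<open>t / norm v\<close> along
  \<open>v = norm v *\<^sub>R e\<close>, so unit directions suffice.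
\<close>

lemma clarke_jahn_stationaryI:
  assumes xbar: "xbar \<in> cbox l u"
    and ascent: "\<And>e \<epsilon>. e \<in> feasible_dirs l u xbar \<Longrightarrow> norm e = 1 \<Longrightarrow> \<epsilon> > 0 \<Longrightarrow>
      \<exists>z t. z \<in> cbox l u \<and> dist z xbar < \<epsilon> \<and> 0 < t \<and> t < \<epsilon> \<and>
        z + t *\<^sub>R e \<in> cbox l u \<and> - \<epsilon> * t \<le> G (z + t *\<^sub>R e) - G z"
  shows "clarke_jahn_stationary l u G xbar"
  unfolding clarke_jahn_stationary_def
proof (intro conjI ballI clarke_jahn_deriv_nonnegI xbar)
  fix v and \<epsilon> :: real
  assume v: "v \<in> feasible_dirs l u xbar" and \<epsilon>: "\<epsilon> > 0"
  show "\<exists>z t. z \<in> cbox l u \<and> dist z xbar < \<epsilon> \<and> 0 < t \<and> t < \<epsilon> \<and>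
      z + t *\<^sub>R v \<in> cbox l u \<and> - \<epsilon> * t \<le> G (z + t *\<^sub>R v) - G z"
  proof (cases "v = 0")
    case True
    show ?thesis
      using \<epsilon> xbar by (intro exI[of _ xbar] exI[of _ "\<epsilon> / 2"]) (auto simp: True)
  next
    case False
    define r where "r = norm v"
    have r: "r > 0" using False by (simp add: r_def)
    define e where "e = (1 / r) *\<^sub>R v"
    have e: "norm e = 1" "e \<in> feasible_dirs l u xbar" "v = r *\<^sub>R e"
      using r v by (auto simp: e_def r_def feasible_dirs_def divide_nonpos_pos)
    \<comment> \<open>The three bounds keep the base point close, the rescaled step short and the rescaled slope small.\<close>
    define \<epsilon>' where "\<epsilon>' = min \<epsilon> (min (\<epsilon> * r) (\<epsilon> / r))"
    have \<epsilon>': "\<epsilon>' > 0" "\<epsilon>' \<le> \<epsilon>" "\<epsilon>' \<le> \<epsilon> * r" "\<epsilon>' \<le> \<epsilon> / r"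
      using \<epsilon> r by (auto simp: \<epsilon>'_def)
    obtain z t where zt: "z \<in> cbox l u" "dist z xbar < \<epsilon>'" "0 < t" "t < \<epsilon>'"
        "z + t *\<^sub>R e \<in> cbox l u" "- \<epsilon>' * t \<le> G (z + t *\<^sub>R e) - G z"
      using ascent[OF e(2,1) \<epsilon>'(1)] by blast
    have same: "(t / r) *\<^sub>R v = t *\<^sub>R e"
      using r by (simp add: e_def)
    have "t / r < \<epsilon>"
      using zt(4) \<epsilon>'(3) r by (simp add: field_simps)
    moreover have "\<epsilon>' * t \<le> \<epsilon> / r * t"
      using \<epsilon>'(4) zt(3) by (intro mult_right_mono) auto
    ultimately show ?thesis
      using zt \<epsilon>'(2) r by (intro exI[of _ z] exI[of _ "t / r"]) (auto simp: same)
  qed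
qed

section \<open>Recurrence of a dense sequence of directions\<close>

lemma CARD_1_eq_scaleR:
  fixes a b :: "real ^ 'n"
  assumes "CARD('n) = 1" "norm a = 1"
  shows "b = (b \<bullet> a) *\<^sub>R a"
proof -
  obtain i :: 'n where i: "UNIV = {i}"
    using assms(1) card_1_singletonE by blast
  have only: "j = i" for j :: 'n
    using i by auto
  have "a \<bullet> a = 1"
    using assms(2) by (simp add: dot_square_norm)
  then have "a $ i * a $ i = 1"
    by (simp add: inner_vec_def i)
  then have "b $ j = (b \<bullet> a) * a $ j" for j
    by (simp add: inner_vec_def i only[of j] mult.assoc)
  then show ?thesis
    by (simp add: vec_eq_iff)
qed

text \<open>
  Density only provides some index. In dimension at least two it can be taken arbitrarily large:
  the sphere is connected, so \<open>e\<close> is an accumulation point of it, and a point \<open>w\<close> of the sphere near \<open>e\<close>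
  that differs from the finitely many directions \<open>d k\<close> with \<open>k < N\<close> can only be approximated by later
  ones. In dimension one the sphere is \<open>{e, - e}\<close> and the second alternative cannot be excluded.
\<close>

lemma dense_directions_recur:
  fixes d :: "nat \<Rightarrow> real ^ 'n"
  assumes unit: "\<And>k. norm (d k) = 1" and inf: "infinite K" and dense: "dense_in_unit_sphere d K"
    and e: "norm e = 1" and \<epsilon>: "\<epsilon> > 0"
  obtains k where "k \<in> K" "k \<ge> N" "norm (d k - e) \<le> \<epsilon> \<or> CARD('n) = 1 \<and> d k = - e"
proof (cases "CARD('n) = 1")
  case True
  obtain k where k: "k \<in> K" "k \<ge> N"
    using inf unfolding infinite_nat_iff_unbounded_le by blast
  have dk: "d k = (d k \<bullet> e) *\<^sub>R e"
    using CARD_1_eq_scaleR[OF True e] .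
  then have "\<bar>d k \<bullet> e\<bar> = 1"
    using unit[of k] e by (metis mult.right_neutral norm_scaleR)
  then have "d k = e \<or> d k = - e"
    using dk by (metis abs_eq_iff abs_1 scaleR_one scaleR_minus1_left)
  then show thesis
    using that[OF k] True \<epsilon> by auto
next
  case False
  have "CARD('n) > 0" by simp
  then have "2 \<le> CARD('n)"
    using False by linarith
  then have dim: "2 \<le> DIM(real ^ 'n)"
    by simp
  have "e islimpt sphere 0 1"
  proof (rule connected_imp_perfect)
    show "connected (sphere (0::real^'n) 1)"
      using connected_sphere[OF dim] .
    show "e \<in> sphere 0 1" using e by simp
    show "sphere 0 1 \<noteq> {a}" for a :: "real ^ 'n"
    proof
      assume "sphere 0 1 = {a}"
      moreover have "e \<in> sphere 0 1" "- e \<in> sphere 0 1" using e by auto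
      ultimately have "- e = e" by (metis singletonD)
      then have "e $ i = 0" for i
        by (metis neg_equal_zero vector_uminus_component)
      then have "e = 0" by (simp add: vec_eq_iff)
      then show False using e by simp
    qed
  qed
  then have "infinite (sphere 0 1 \<inter> ball e (\<epsilon> / 2))"
    using \<epsilon> by (simp add: islimpt_eq_infinite_ball)
  then obtain w where w: "w \<in> sphere 0 1" "w \<in> ball e (\<epsilon> / 2)" "w \<notin> d ` {..<N}"
    by (metis finite_imageI finite_lessThan infinite_super subsetI IntE)
  obtain r where r: "r > 0" "\<And>v. v \<in> d ` {..<N} \<Longrightarrow> v \<noteq> w \<Longrightarrow> r \<le> dist w v"
    using finite_set_avoid[of "d ` {..<N}" w] by auto
  have "min (\<epsilon> / 2) (r / 2) > 0" using \<epsilon> r(1) by simp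
  then obtain k where k: "k \<in> K" "norm (d k - w) \<le> min (\<epsilon> / 2) (r / 2)"
    using dense w(1) unfolding dense_in_unit_sphere_def by blast
  have "k \<ge> N"
  proof (rule ccontr)
    assume "\<not> k \<ge> N"
    then have "d k \<in> d ` {..<N}" by auto
    then have "r \<le> dist w (d k)" using r(2) w(3) by metis
    then show False using k(2) r(1) by (simp add: dist_norm norm_minus_commute)
  qed
  moreover have "norm (d k - e) \<le> \<epsilon>"
    using norm_triangle_ineq[of "d k - w" "w - e"] k(2) w(2)
    by (simp add: dist_norm norm_minus_commute)
  ultimately show thesis
    using that k(1) by blast
qed

section \<open>What the line search returns\<close>

definition sufficient_decrease ::
  "real ^ 'n \<Rightarrow> real ^ 'n \<Rightarrow> (real ^ 'n \<Rightarrow> real \<Rightarrow> real) \<Rightarrow> real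
    \<Rightarrow> real ^ 'n \<Rightarrow> real \<Rightarrow> real ^ 'n \<Rightarrow> real \<Rightarrow> bool" where
  "sufficient_decrease l u P \<gamma> x \<zeta> p \<alpha> \<longleftrightarrow>
     P (box_proj l u (x + \<alpha> *\<^sub>R p)) \<zeta> \<le> P x \<zeta> - \<gamma> * \<alpha>\<^sup>2"

lemma expand_SomeD:
  assumes "expand l u P \<gamma> \<delta> \<alpha>0 x p \<zeta> = Some \<alpha>" "0 < \<delta>" "\<delta> < 1" "0 < \<alpha>0"
    and "sufficient_decrease l u P \<gamma> x \<zeta> p \<alpha>0"
  shows "\<alpha>0 \<le> \<alpha>" "sufficient_decrease l u P \<gamma> x \<zeta> p \<alpha>"
    "\<not> sufficient_decrease l u P \<gamma> x \<zeta> p (\<alpha> / \<delta>)"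
proof -
  have loop: "while_option (\<lambda>\<alpha>. sufficient_decrease l u P \<gamma> x \<zeta> p (\<alpha> / \<delta>)) (\<lambda>\<alpha>. \<alpha> / \<delta>) \<alpha>0 = Some \<alpha>"
    using assms(1) unfolding expand_def sufficient_decrease_def .
  have "\<alpha>0 \<le> \<alpha> \<and> sufficient_decrease l u P \<gamma> x \<zeta> p \<alpha>"
  proof (rule while_option_rule[OF _ loop])
    fix s assume s: "\<alpha>0 \<le> s \<and> sufficient_decrease l u P \<gamma> x \<zeta> p s"
      "sufficient_decrease l u P \<gamma> x \<zeta> p (s / \<delta>)"
    have "s * \<delta> \<le> s"
      using s(1) assms(2-4) by (intro mult_left_le) auto
    then have "s \<le> s / \<delta>"
      using assms(2) by (simp add: pos_le_divide_eq)
    then show "\<alpha>0 \<le> s / \<delta> \<and> sufficient_decrease l u P \<gamma> x \<zeta> p (s / \<delta>)"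
      using s by linarith
  qed (use assms in auto)
  then show "\<alpha>0 \<le> \<alpha>" "sufficient_decrease l u P \<gamma> x \<zeta> p \<alpha>" by auto
  show "\<not> sufficient_decrease l u P \<gamma> x \<zeta> p (\<alpha> / \<delta>)"
    using while_option_stop[OF loop] .
qed

text \<open>
  In the last case the line search goes along \<open>- d\<close>, but only after \<open>d\<close> has failed at the tentative
  step. This is what makes \<open>d\<close> itself fail at some step whatever the outcome.
\<close>

lemma projected_extrapolation_SomeE:
  assumes "projected_extrapolation l u P \<gamma> \<delta> \<alpha>0 x d \<zeta> = Some (\<alpha>, p)" "0 < \<delta>" "\<delta> < 1" "0 < \<alpha>0"
  obtains
    (unsuccessful) "\<alpha> = 0" "\<not> sufficient_decrease l u P \<gamma> x \<zeta> d \<alpha>0"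
      "\<not> sufficient_decrease l u P \<gamma> x \<zeta> (- d) \<alpha>0"
  | (forward) "p = d" "\<alpha>0 \<le> \<alpha>" "sufficient_decrease l u P \<gamma> x \<zeta> d \<alpha>"
      "\<not> sufficient_decrease l u P \<gamma> x \<zeta> d (\<alpha> / \<delta>)"
  | (backward) "p = - d" "\<alpha>0 \<le> \<alpha>" "sufficient_decrease l u P \<gamma> x \<zeta> (- d) \<alpha>"
      "\<not> sufficient_decrease l u P \<gamma> x \<zeta> (- d) (\<alpha> / \<delta>)"
      "\<not> sufficient_decrease l u P \<gamma> x \<zeta> d \<alpha>0"
proof (cases "sufficient_decrease l u P \<gamma> x \<zeta> d \<alpha>0")
  case True
  then have "expand l u P \<gamma> \<delta> \<alpha>0 x d \<zeta> = Some \<alpha>" "p = d"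
    using assms(1) by (auto simp: projected_extrapolation_def sufficient_decrease_def)
  then show thesis
    using forward expand_SomeD[OF _ assms(2-4) True] by blast
next
  case not_d: False
  show thesis
  proof (cases "sufficient_decrease l u P \<gamma> x \<zeta> (- d) \<alpha>0")
    case True
    then have "expand l u P \<gamma> \<delta> \<alpha>0 x (- d) \<zeta> = Some \<alpha>" "p = - d"
      using assms(1) not_d by (auto simp: projected_extrapolation_def sufficient_decrease_def)
    then show thesis
      using backward not_d expand_SomeD[OF _ assms(2-4) True] by blast
  next
    case False
    then have "\<alpha> = 0"
      using assms(1) not_d by (auto simp: projected_extrapolation_def sufficient_decrease_def)
    then show thesis
      using unsuccessful not_d False by blast
  qed
qed

section \<open>Runs with an inexact objective\<close>

text \<open>
  The lower level enters only through the error bound: \<open>P\<close> evaluates \<open>G\<close> with an error that is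
  proportional to the accuracy parameter.
\<close>

locale inexact_dfn_lla =
  fixes l u :: "real ^ 'n" and P :: "real ^ 'n \<Rightarrow> real \<Rightarrow> real" and G :: "real ^ 'n \<Rightarrow> real"
    and L low \<gamma> \<delta> \<theta> \<sigma> :: real
    and d x :: "nat \<Rightarrow> real ^ 'n" and \<alpha>t \<zeta> :: "nat \<Rightarrow> real"
  assumes error: "\<And>w s. w \<in> cbox l u \<Longrightarrow> s > 0 \<Longrightarrow> \<bar>P w s - G w\<bar> \<le> L * s"
    and L_nonneg: "L \<ge> 0"
    and low: "\<And>w. w \<in> cbox l u \<Longrightarrow> low \<le> G w"
    and \<gamma>: "\<gamma> > 0" and \<delta>: "0 < \<delta>" "\<delta> < 1" and \<theta>: "0 < \<theta>" "\<theta> < 1"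
    and run: "dfn_lla_run l u P \<gamma> \<delta> \<theta> \<sigma> 0 d x \<alpha>t \<zeta>"
    and \<zeta>0: "\<zeta> 0 > 0"
begin

abbreviation decreases :: "nat \<Rightarrow> real ^ 'n \<Rightarrow> real \<Rightarrow> bool" where
  "decreases k \<equiv> sufficient_decrease l u P \<gamma> (x k) (\<zeta> k)"

lemma step: "dfn_lla_step l u P \<gamma> \<delta> \<theta> \<sigma> 0 (d k)
    (x k) (\<alpha>t k) (\<zeta> k) (x (Suc k)) (\<alpha>t (Suc k)) (\<zeta> (Suc k))"
  and norm_d: "norm (d k) = 1"
  using run by (auto simp: dfn_lla_run_def)

lemma box_proj_feasible: "box_proj l u w \<in> cbox l u"
  by (rule box_proj_in_cbox) (use run in \<open>auto simp: dfn_lla_run_def\<close>)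

lemma step_cases:
  assumes "\<alpha>t k > 0"
  obtains
    (unsuccessful) "\<not> decreases k (d k) (\<alpha>t k)" "\<not> decreases k (- d k) (\<alpha>t k)"
      "\<alpha>t (Suc k) = \<theta> * \<alpha>t k" "x (Suc k) = x k"
      "\<zeta> (Suc k) = (if \<alpha>t (Suc k) ^ 3 < \<zeta> k then max 0 (min (\<theta> * \<zeta> k) (\<alpha>t (Suc k) ^ 3)) else \<zeta> k)"
  | (successful) p where "p = d k \<or> p = - d k \<and> \<not> decreases k (d k) (\<alpha>t k)"
      "\<alpha>t k \<le> \<alpha>t (Suc k)" "decreases k p (\<alpha>t (Suc k))" "\<not> decreases k p (\<alpha>t (Suc k) / \<delta>)"
      "\<zeta> (Suc k) = \<zeta> k" "x (Suc k) \<in> cbox l u"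
      "P (x (Suc k)) (\<zeta> k) \<le> P (x k) (\<zeta> k) - \<gamma> * (\<alpha>t (Suc k))\<^sup>2"
proof -
  obtain \<alpha> p where pe: "projected_extrapolation l u P \<gamma> \<delta> (\<alpha>t k) (x k) (d k) (\<zeta> k) = Some (\<alpha>, p)"
    and upd: "\<alpha> = 0 \<and> \<alpha>t (Suc k) = max (root 3 (\<sigma> * 0)) (\<theta> * \<alpha>t k) \<and> x (Suc k) = x k \<and>
           \<zeta> (Suc k) = (if \<alpha>t (Suc k) ^ 3 < \<zeta> k then max 0 (min (\<theta> * \<zeta> k) (\<alpha>t (Suc k) ^ 3)) else \<zeta> k)
         \<or> \<alpha> > 0 \<and> \<alpha>t (Suc k) = \<alpha> \<and> \<zeta> (Suc k) = \<zeta> k \<and>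
           x (Suc k) \<in> cbox l u \<and> P (x (Suc k)) (\<zeta> k) \<le> P (box_proj l u (x k + \<alpha> *\<^sub>R p)) (\<zeta> k)"
    using step[of k] unfolding dfn_lla_step_def by blast
  have max0: "max (root 3 (\<sigma> * 0)) (\<theta> * \<alpha>t k) = \<theta> * \<alpha>t k"
    using \<theta> assms by simp
  from pe \<delta> assms show thesis
  proof (cases rule: projected_extrapolation_SomeE)
    case unsuccessful
    then show thesis using that(1) upd max0 by simp
  next
    case forward
    then have "\<alpha> > 0" using assms by linarith
    then show thesis
      using that(2)[of p] forward upd by (auto simp: sufficient_decrease_def)
  next
    case backward
    then have "\<alpha> > 0" using assms by linarith
    then show thesis
      using that(2)[of p] backward upd by (auto simp: sufficient_decrease_def)
  qed
qed

text \<open>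
  The bound \<open>\<zeta> k \<le> \<alpha>t k ^ 3\<close> makes the error of \<open>P\<close> of lower order than the decrease
  \<open>\<gamma> * (\<alpha>t k)\<^sup>2\<close> that the line search asks for. It holds initially, a success only enlarges \<open>\<alpha>t\<close>, and
  after a failure the update of \<open>\<zeta>\<close> enforces it.
\<close>

lemma invariant: "x k \<in> cbox l u \<and> 0 < \<alpha>t k \<and> 0 < \<zeta> k \<and> \<zeta> k \<le> \<alpha>t k ^ 3"
proof (induction k)
  case 0
  have a: "root 3 (\<zeta> 0) \<le> \<alpha>t 0" and x0: "x 0 \<in> cbox l u"
    using run by (auto simp: dfn_lla_run_def)
  have r: "0 < root 3 (\<zeta> 0)" using \<zeta>0 by simp
  have "\<zeta> 0 = root 3 (\<zeta> 0) ^ 3" using \<zeta>0 by simp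
  also have "\<dots> \<le> \<alpha>t 0 ^ 3" using a r by (intro power_mono) auto
  finally show ?case using a r \<zeta>0 x0 by linarith
next
  case (Suc k)
  then have pos: "\<alpha>t k > 0" by blast
  then show ?case
  proof (cases rule: step_cases)
    case unsuccessful
    then have "\<alpha>t (Suc k) > 0" using pos \<theta> by simp
    then show ?thesis using unsuccessful Suc \<theta> by auto
  next
    case (successful p)
    then have "\<alpha>t k ^ 3 \<le> \<alpha>t (Suc k) ^ 3" using pos by (intro power_mono) auto
    then show ?thesis using successful Suc by linarith
  qed
qed

lemmas x_feasible = invariant[THEN conjunct1]
lemmas \<alpha>t_pos = invariant[THEN conjunct2, THEN conjunct1]
lemmas \<zeta>_pos = invariant[THEN conjunct2, THEN conjunct2, THEN conjunct1]
lemmas \<zeta>_le_cube = invariant[THEN conjunct2, THEN conjunct2, THEN conjunct2]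

text \<open>
  The accuracy changes only in iterations that keep the iterate, and then to at most \<open>\<theta> * \<zeta> k\<close>, so that
  \<open>P\<close> jumps by at most \<open>2 * L * \<zeta> k\<close>, which is at most \<open>2 * L / (1 - \<theta>)\<close> times the drop of \<open>\<zeta>\<close>:
  hence the second coefficient. The square of the tentative step covers the unsuccessful iterations,
  in which \<open>P\<close> need not decrease but \<open>\<alpha>t\<close> contracts by \<open>\<theta>\<close>; with the factor \<open>\<gamma> / 2\<close>, the decrease
  \<open>\<gamma> * (\<alpha>t (Suc k))\<^sup>2\<close> of a successful iteration pays for the enlarged square.
\<close>

definition potential :: "nat \<Rightarrow> real" where
  "potential k = P (x k) (\<zeta> k) + 2 * L / (1 - \<theta>) * \<zeta> k + \<gamma> / 2 * (\<alpha>t k)\<^sup>2"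

lemma potential_decrease:
  "potential (Suc k) \<le> potential k - \<gamma> / 2 * (1 - \<theta>\<^sup>2) * (\<alpha>t k)\<^sup>2"
  using \<alpha>t_pos[of k]
proof (cases rule: step_cases)
  case unsuccessful
  define C where "C = 2 * L / (1 - \<theta>)"
  have C: "C \<ge> 0" "C * (1 - \<theta>) = 2 * L"
    using \<theta> L_nonneg by (auto simp: C_def)
  have P: "P (x k) (\<zeta> (Suc k)) + C * \<zeta> (Suc k) \<le> P (x k) (\<zeta> k) + C * \<zeta> k"
  proof (cases "\<zeta> (Suc k) = \<zeta> k")
    case False
    then have shrink: "\<zeta> (Suc k) \<le> \<theta> * \<zeta> k"
      using unsuccessful \<zeta>_pos[of k] \<zeta>_pos[of "Suc k"] by (auto split: if_splits)
    have "\<theta> * \<zeta> k \<le> \<zeta> k"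
      using \<theta> \<zeta>_pos[of k] by (simp add: mult_le_cancel_right1)
    then have "L * \<zeta> (Suc k) \<le> L * \<zeta> k"
      using shrink L_nonneg by (intro mult_left_mono) auto
    then have "P (x k) (\<zeta> (Suc k)) - P (x k) (\<zeta> k) \<le> 2 * L * \<zeta> k"
      using error[OF x_feasible \<zeta>_pos, of k k] error[OF x_feasible \<zeta>_pos, of k "Suc k"]
      by linarith
    also have "\<dots> = C * (\<zeta> k - \<theta> * \<zeta> k)"
      unfolding C(2)[symmetric] by (simp add: algebra_simps)
    also have "\<dots> \<le> C * (\<zeta> k - \<zeta> (Suc k))"
      using shrink C(1) by (intro mult_left_mono) auto
    finally show ?thesis by (simp add: algebra_simps)
  qed simp
  have "\<gamma> / 2 * (\<alpha>t (Suc k))\<^sup>2 = \<gamma> / 2 * (\<alpha>t k)\<^sup>2 - \<gamma> / 2 * (1 - \<theta>\<^sup>2) * (\<alpha>t k)\<^sup>2"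
    using unsuccessful(3) by (simp add: power_mult_distrib algebra_simps)
  then show ?thesis
    using P unfolding potential_def C_def[symmetric] unsuccessful(4) by linarith
next
  case (successful p)
  have "\<gamma> / 2 * (1 - \<theta>\<^sup>2) * (\<alpha>t k)\<^sup>2 \<le> \<gamma> / 2 * (\<alpha>t k)\<^sup>2"
    using \<gamma> by (intro mult_right_mono) auto
  moreover have "0 \<le> \<gamma> * (\<alpha>t (Suc k))\<^sup>2"
    using \<gamma> by simp
  ultimately show ?thesis
    using successful(7) unfolding potential_def successful(5) by linarith
qed

text \<open>
  The second coefficient is at least \<open>L\<close>, so it also absorbs the amount by which \<open>P\<close> may lie below \<open>G\<close>.
\<close>

lemma potential_ge_low: "potential k \<ge> low"
proof -
  have "L * \<zeta> k \<le> 2 * L / (1 - \<theta>) * \<zeta> k"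
  proof (rule mult_right_mono)
    have "L * (1 - \<theta>) \<le> 2 * L"
      using mult_left_mono[OF _ L_nonneg, of "1 - \<theta>" 2] \<theta> by (simp add: mult.commute)
    then show "L \<le> 2 * L / (1 - \<theta>)"
      using \<theta> by (simp add: pos_le_divide_eq)
  qed (use \<zeta>_pos[of k] in auto)
  moreover have "0 \<le> \<gamma> / 2 * (\<alpha>t k)\<^sup>2" using \<gamma> by simp
  ultimately show ?thesis
    using error[OF x_feasible \<zeta>_pos, of k k] low[OF x_feasible[of k]]
    unfolding potential_def by linarith
qed

lemma \<alpha>t_tendsto_0: "\<alpha>t \<longlonglongrightarrow> 0"
proof -
  define c where "c = \<gamma> / 2 * (1 - \<theta>\<^sup>2)"
  have c: "c > 0" using \<gamma> \<theta> by (simp add: c_def power_less_one_iff abs_square_less_1)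
  have "(\<Sum>i<k. c * (\<alpha>t i)\<^sup>2) \<le> potential 0 - potential k" for k
  proof (induction k)
    case (Suc k)
    then show ?case using potential_decrease[of k] by (simp add: c_def)
  qed simp
  then have "(\<Sum>i<k. c * (\<alpha>t i)\<^sup>2) \<le> potential 0 - low" for k
    using potential_ge_low[of k] by (meson diff_left_mono order_trans)
  then have "summable (\<lambda>i. c * (\<alpha>t i)\<^sup>2)"
    using c by (intro summableI_nonneg_bounded) auto
  then have "(\<lambda>i. (\<alpha>t i)\<^sup>2) \<longlonglongrightarrow> 0"
    using c summable_LIMSEQ_zero tendsto_mult_left_iff[of c "\<lambda>i. (\<alpha>t i)\<^sup>2" 0] by fastforce
  then show ?thesis by (simp add: power_tendsto_0_iff)
qed

lemma \<alpha>t_le_enlarged: "\<alpha>t k \<le> \<alpha>t k / \<delta>"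
proof -
  have "\<alpha>t k * \<delta> \<le> \<alpha>t k"
    using \<alpha>t_pos[of k] \<delta> by (intro mult_left_le) auto
  then show ?thesis
    using \<delta> by (simp add: pos_le_divide_eq)
qed

text \<open>
  The failing step is the tentative one, or the enlarged one at which the expansion along \<open>d k\<close> stopped.
\<close>

lemma direction_fails:
  obtains \<eta> where "\<alpha>t k \<le> \<eta>" "\<eta> \<le> max (\<alpha>t k) (\<alpha>t (Suc k) / \<delta>)" "\<not> decreases k (d k) \<eta>"
  using \<alpha>t_pos[of k]
proof (cases rule: step_cases)
  case unsuccessful
  then show thesis using that[of "\<alpha>t k"] by simp
next
  case (successful p)
  show thesis
    using successful(1,2,4) \<alpha>t_le_enlarged[of "Suc k"] that[of "\<alpha>t k"] that[of "\<alpha>t (Suc k) / \<delta>"] by auto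
qed

text \<open>
  If the line search expands along \<open>d k\<close>, then \<open>- d k\<close> is never tested; the accepted step is then the
  available information.
\<close>

lemma opposite_direction_fails_or_decrease:
  obtains \<eta> where "\<alpha>t k \<le> \<eta>" "\<eta> \<le> max (\<alpha>t k) (\<alpha>t (Suc k) / \<delta>)"
    "\<not> decreases k (- d k) \<eta> \<or> decreases k (d k) \<eta>"
  using \<alpha>t_pos[of k]
proof (cases rule: step_cases)
  case unsuccessful
  then show thesis using that[of "\<alpha>t k"] by simp
next
  case (successful p)
  have le: "\<alpha>t (Suc k) \<le> \<alpha>t (Suc k) / \<delta>"
    by (rule \<alpha>t_le_enlarged)
  show thesis
  proof (cases "p = d k")
    case True
    then show thesis using that[of "\<alpha>t (Suc k)"] successful le by auto
  next
    case False
    then show thesis using that[of "\<alpha>t (Suc k) / \<delta>"] successful le by auto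
  qed
qed

lemma oracle_difference:
  assumes "v \<in> cbox l u" "w \<in> cbox l u" "\<alpha>t k \<le> \<eta>"
  shows "P v (\<zeta> k) - P w (\<zeta> k) - 2 * L * \<eta> ^ 3 \<le> G v - G w"
proof -
  have "\<alpha>t k ^ 3 \<le> \<eta> ^ 3"
    using assms(3) \<alpha>t_pos[of k] by (intro power_mono) auto
  then have "L * \<zeta> k \<le> L * \<eta> ^ 3"
    using \<zeta>_le_cube[of k] L_nonneg by (intro mult_left_mono) auto
  then show ?thesis
    using error[OF assms(1) \<zeta>_pos, of k] error[OF assms(2) \<zeta>_pos, of k] by linarith
qed

text \<open>
  The three losses are the tolerated decrease \<open>\<gamma> * \<eta>\<^sup>2\<close>, the error \<open>2 * L * \<eta> ^ 3 \<le> 2 * L * \<eta>\<^sup>2\<close> of \<open>P\<close>,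
  and \<open>C * \<eta> * norm (p - e)\<close> for replacing the projected trial point along \<open>p\<close> by the point along \<open>e\<close>.
  The last bound holds because the point along \<open>e\<close> is its own projection and projecting is
  nonexpansive.
\<close>

lemma ascent_of_failure:
  assumes fail: "\<not> decreases k p \<eta>" and \<eta>: "\<alpha>t k \<le> \<eta>" "\<eta> \<le> 1"
    and lip: "C-lipschitz_on (cbox l u) G" and feas: "x k + \<eta> *\<^sub>R e \<in> cbox l u"
  shows "- ((\<gamma> + 2 * L) * \<eta> + C * norm (p - e)) * \<eta> \<le> G (x k + \<eta> *\<^sub>R e) - G (x k)"
proof -
  have \<eta>0: "\<eta> > 0" using \<eta>(1) \<alpha>t_pos[of k] by linarith
  let ?v = "box_proj l u (x k + \<eta> *\<^sub>R p)"
  have "G ?v - G (x k) \<ge> - \<gamma> * \<eta>\<^sup>2 - 2 * L * \<eta> ^ 3"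
    using oracle_difference[OF box_proj_feasible[of "x k + \<eta> *\<^sub>R p"] x_feasible[of k] \<eta>(1)] fail
    unfolding sufficient_decrease_def by linarith
  moreover have "L * \<eta> ^ 3 \<le> L * \<eta>\<^sup>2"
    using \<eta>(2) \<eta>0 L_nonneg by (intro mult_left_mono power_decreasing) auto
  moreover have "G ?v - G (x k + \<eta> *\<^sub>R e) \<le> C * (\<eta> * norm (p - e))"
  proof -
    have C: "C \<ge> 0" using lip by (rule lipschitz_on_nonneg)
    have "norm (?v - (x k + \<eta> *\<^sub>R e)) \<le> norm ((x k + \<eta> *\<^sub>R p) - (x k + \<eta> *\<^sub>R e))"
      using box_proj_nonexpansive[of l u "x k + \<eta> *\<^sub>R p" "x k + \<eta> *\<^sub>R e"] box_proj_id[OF feas]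
      by simp
    also have "\<dots> = \<eta> * norm (p - e)"
      using \<eta>0 by (simp flip: scaleR_right_diff_distrib)
    finally have "C * norm (?v - (x k + \<eta> *\<^sub>R e)) \<le> C * (\<eta> * norm (p - e))"
      using C by (intro mult_left_mono)
    then show ?thesis
      using lipschitz_onD[OF lip box_proj_feasible[of "x k + \<eta> *\<^sub>R p"] feas]
      by (simp add: dist_norm)
  qed
  ultimately show ?thesis
    by (simp add: algebra_simps power2_eq_square)
qed

text \<open>
  On a line, the projected trial point \<open>z\<close> along \<open>- e\<close> and \<open>x k\<close> differ by a multiple of \<open>e\<close>. The
  projection may make the displacement \<open>t\<close> much shorter than \<open>\<eta>\<close>, so an error term of order \<open>\<eta>\<^sup>2\<close>
  would not be negligible against \<open>t\<close>. The condition \<open>2 * L * \<eta> \<le> \<gamma>\<close> therefore ensures that the decrease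
  outweighs the error of \<open>P\<close> altogether.
\<close>

lemma ascent_of_opposite_decrease:
  assumes dim: "CARD('n) = 1" and e: "norm e = 1"
    and dec: "decreases k (- e) \<eta>" and \<eta>: "\<alpha>t k \<le> \<eta>" "2 * L * \<eta> \<le> \<gamma>"
  obtains z t where "z \<in> cbox l u" "norm (z - x k) \<le> \<eta>" "0 < t" "t \<le> \<eta>" "x k = z + t *\<^sub>R e"
    "G z \<le> G (x k)"
proof -
  have \<eta>0: "\<eta> > 0" using \<eta>(1) \<alpha>t_pos[of k] by linarith
  define z where "z = box_proj l u (x k - \<eta> *\<^sub>R e)"
  define t where "t = (x k - z) \<bullet> e"
  have z: "z \<in> cbox l u" unfolding z_def by (rule box_proj_feasible)
  have decz: "P z (\<zeta> k) \<le> P (x k) (\<zeta> k) - \<gamma> * \<eta>\<^sup>2"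
    using dec by (simp add: sufficient_decrease_def z_def)
  have nz: "norm (z - x k) \<le> \<eta>"
    using box_proj_nonexpansive[of l u "x k - \<eta> *\<^sub>R e" "x k"] box_proj_id[OF x_feasible[of k]] e \<eta>0
    by (simp add: z_def)
  have xz: "x k - z = t *\<^sub>R e"
    unfolding t_def by (rule CARD_1_eq_scaleR[OF dim e])
  have "x k \<noteq> z"
  proof
    assume "x k = z"
    then have "\<gamma> * \<eta>\<^sup>2 \<le> 0" using decz by simp
    then show False using \<gamma> \<eta>0 by (simp add: mult_le_0_iff)
  qed
  then have "t \<noteq> 0" using xz by auto
  moreover have "t \<ge> 0"
    unfolding t_def inner_vec_def
  proof (rule sum_nonneg)
    fix i
    have x: "l $ i \<le> x k $ i" "x k $ i \<le> u $ i"
      using x_feasible[of k] by (auto simp: mem_box_cart)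
    show "(x k - z) $ i \<bullet> e $ i \<ge> 0"
    proof (cases "e $ i \<ge> 0")
      case True
      then have "\<eta> * e $ i \<ge> 0" using \<eta>0 by simp
      then have "z $ i \<le> x k $ i" using x by (auto simp: z_def box_proj_def)
      then show ?thesis using True by simp
    next
      case False
      then have "\<eta> * e $ i \<le> 0" using \<eta>0 by (simp add: mult_nonneg_nonpos)
      then have "z $ i \<ge> x k $ i" using x by (auto simp: z_def box_proj_def)
      then show ?thesis using False by (simp add: mult_nonpos_nonpos)
    qed
  qed
  moreover have "\<bar>t\<bar> = norm (z - x k)"
    using e by (simp add: norm_minus_commute[of z] xz)
  ultimately have t: "0 < t" "t \<le> \<eta>" using nz by auto
  have "2 * L * \<eta> * \<eta>\<^sup>2 \<le> \<gamma> * \<eta>\<^sup>2"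
    using \<eta>(2) by (intro mult_right_mono) auto
  then have "2 * L * \<eta> ^ 3 \<le> \<gamma> * \<eta>\<^sup>2"
    by (simp add: power2_eq_square power3_eq_cube mult.assoc)
  then have "G z \<le> G (x k)"
    using oracle_difference[OF x_feasible[of k] z \<eta>(1)] decz by linarith
  moreover have "x k = z + t *\<^sub>R e" using xz by (simp add: algebra_simps)
  ultimately show thesis using that z nz t by blast
qed

text \<open>
  The base point is the iterate \<open>x k\<close> itself, for an index \<open>k\<close> in \<open>K\<close> whose direction fails, except in
  dimension one after a decrease along \<open>- e\<close>, where it is the trial point of that decrease.
\<close>

lemma limit_point_ascent:
  assumes lip: "C-lipschitz_on (cbox l u) G"
    and K: "infinite K" "(x \<longlongrightarrow> xbar) (inf sequentially (principal K))" "dense_in_unit_sphere d K"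
    and xbar: "xbar \<in> cbox l u" and e: "e \<in> feasible_dirs l u xbar" "norm e = 1" and \<epsilon>: "\<epsilon> > 0"
  shows "\<exists>z t. z \<in> cbox l u \<and> dist z xbar < \<epsilon> \<and> 0 < t \<and> t < \<epsilon> \<and>
      z + t *\<^sub>R e \<in> cbox l u \<and> - \<epsilon> * t \<le> G (z + t *\<^sub>R e) - G z"
proof -
  have C: "C \<ge> 0" using lip by (rule lipschitz_on_nonneg)
  obtain \<rho> where \<rho>: "\<rho> > 0"
    "\<And>z t. z \<in> cbox l u \<Longrightarrow> dist z xbar < \<rho> \<Longrightarrow> 0 \<le> t \<Longrightarrow> t < \<rho> \<Longrightarrow> z + t *\<^sub>R e \<in> cbox l u"
    using feasible_dirs_uniform_step[OF xbar e] by blast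
  \<comment> \<open>Bounds, in this order, for \<open>\<eta> ^ 3 \<le> \<eta>\<^sup>2\<close>, feasibility of the step, closeness to \<open>xbar\<close> of a base
     point displaced by \<open>\<eta>\<close>, a slope loss of at most \<open>\<epsilon> / 2\<close>, and \<open>2 * L * \<eta> \<le> \<gamma>\<close>.\<close>
  define h where "h = Min {1, \<rho>, \<epsilon> / 2, \<epsilon> / (2 * (\<gamma> + 2 * L)), \<gamma> / (2 * L + 1)}"
  have h: "h > 0" "h \<le> 1" "h \<le> \<rho>" "h \<le> \<epsilon> / 2" "h \<le> \<epsilon> / (2 * (\<gamma> + 2 * L))" "h \<le> \<gamma> / (2 * L + 1)"
  proof -
    show "h > 0"
      unfolding h_def using \<rho>(1) \<epsilon> \<gamma> L_nonneg by (simp add: add_pos_nonneg)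
  qed (unfold h_def, (rule Min_le, simp, blast)+)
  have "\<forall>\<^sub>F k in inf sequentially (principal K). dist (x k) xbar < h"
    using K(2) h(1) tendstoD by blast
  then obtain N1 where N1: "\<And>k. k \<ge> N1 \<Longrightarrow> k \<in> K \<Longrightarrow> dist (x k) xbar < h"
    unfolding eventually_inf_principal eventually_sequentially by blast
  have "h * \<delta> > 0" using h(1) \<delta> by simp
  then have "\<forall>\<^sub>F k in sequentially. \<alpha>t k < h * \<delta>"
    using \<alpha>t_tendsto_0 order_tendstoD(2) by blast
  then obtain N2 where N2: "\<And>k. k \<ge> N2 \<Longrightarrow> \<alpha>t k < h * \<delta>"
    unfolding eventually_sequentially by blast
  have small: "\<eta> < h" if "k \<ge> N2" "\<eta> \<le> max (\<alpha>t k) (\<alpha>t (Suc k) / \<delta>)" for k \<eta>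
  proof -
    have "\<alpha>t j / \<delta> < h" if "j \<ge> k" for j
      using N2[of j] that \<open>k \<ge> N2\<close> \<delta> by (simp add: pos_divide_less_eq)
    from this[of k] this[of "Suc k"] show ?thesis
      using that(2) \<alpha>t_le_enlarged[of k] by simp
  qed
  define \<epsilon>1 where "\<epsilon>1 = \<epsilon> / (2 * (C + 1))"
  have \<epsilon>1: "\<epsilon>1 > 0" "C * \<epsilon>1 \<le> \<epsilon> / 2"
    using \<epsilon> C by (auto simp: \<epsilon>1_def field_simps)
  have from_failure: ?thesis
    if k: "k \<ge> N1" "k \<in> K" "k \<ge> N2" and \<eta>: "\<alpha>t k \<le> \<eta>" "\<eta> \<le> max (\<alpha>t k) (\<alpha>t (Suc k) / \<delta>)"
      and fail: "\<not> decreases k p \<eta>" and p: "norm (p - e) \<le> \<epsilon>1" for k \<eta> p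
  proof -
    have \<eta>0: "0 < \<eta>" "\<eta> < h" using \<eta>(1) \<alpha>t_pos[of k] small[OF k(3) \<eta>(2)] by linarith+
    have near: "dist (x k) xbar < h" using N1 k by blast
    have feas: "x k + \<eta> *\<^sub>R e \<in> cbox l u"
      using \<rho>(2)[OF x_feasible] near \<eta>0 h(3) by simp
    have "(\<gamma> + 2 * L) * \<eta> \<le> (\<gamma> + 2 * L) * (\<epsilon> / (2 * (\<gamma> + 2 * L)))"
      using \<eta>0 h(5) \<gamma> L_nonneg by (intro mult_left_mono) auto
    also have "\<dots> = \<epsilon> / 2" using \<gamma> L_nonneg by (simp add: field_simps)
    finally have "(\<gamma> + 2 * L) * \<eta> \<le> \<epsilon> / 2" .
    moreover have "C * norm (p - e) \<le> C * \<epsilon>1" using p C by (intro mult_left_mono)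
    ultimately have "((\<gamma> + 2 * L) * \<eta> + C * norm (p - e)) * \<eta> \<le> \<epsilon> * \<eta>"
      using \<epsilon>1(2) \<eta>0 by (intro mult_right_mono) auto
    moreover have "\<eta> \<le> 1" using \<eta>0 h(2) by linarith
    ultimately have "- \<epsilon> * \<eta> \<le> G (x k + \<eta> *\<^sub>R e) - G (x k)"
      using ascent_of_failure[OF fail \<eta>(1) _ lip feas] unfolding mult_minus_left by linarith
    then show ?thesis
      using x_feasible[of k] near \<eta>0 h(4) feas \<epsilon> by (intro exI[of _ "x k"] exI[of _ \<eta>]) auto
  qed
  obtain k where k: "k \<in> K" "k \<ge> max N1 N2" and dk: "norm (d k - e) \<le> \<epsilon>1 \<or> CARD('n) = 1 \<and> d k = - e"
    using dense_directions_recur[OF norm_d K(1,3) e(2) \<epsilon>1(1)] by blast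
  show ?thesis
  proof (cases "norm (d k - e) \<le> \<epsilon>1")
    case True
    then show ?thesis
      using direction_fails[of k] from_failure[of k _ "d k"] k by (metis max.bounded_iff)
  next
    case False
    then have d1: "CARD('n) = 1" "d k = - e" using dk by auto
    obtain \<eta> where \<eta>: "\<alpha>t k \<le> \<eta>" "\<eta> \<le> max (\<alpha>t k) (\<alpha>t (Suc k) / \<delta>)"
      and alt: "\<not> decreases k e \<eta> \<or> decreases k (- e) \<eta>"
      using opposite_direction_fails_or_decrease[of k] d1(2) by auto
    show ?thesis
    proof (cases "decreases k e \<eta>")
      case False
      then show ?thesis using from_failure[of k \<eta> e] k \<eta> \<epsilon>1(1) by simp
    next
      case True
      then have dec: "decreases k (- e) \<eta>" using alt by blast
      have \<eta>h: "\<eta> < h" using small[OF _ \<eta>(2)] k(2) by simp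
      have "(2 * L + 1) * \<eta> \<le> \<gamma>"
      proof -
        have "\<eta> \<le> \<gamma> / (2 * L + 1)" using \<eta>h h(6) by linarith
        then show ?thesis using L_nonneg by (simp add: pos_le_divide_eq mult.commute)
      qed
      then have "2 * L * \<eta> \<le> \<gamma>" using \<eta>(1) \<alpha>t_pos[of k] by (simp add: algebra_simps)
      then obtain z t where zt: "z \<in> cbox l u" "norm (z - x k) \<le> \<eta>" "0 < t" "t \<le> \<eta>"
          "x k = z + t *\<^sub>R e" "G z \<le> G (x k)"
        using ascent_of_opposite_decrease[OF d1(1) e(2) dec \<eta>(1)] by blast
      have "dist z xbar < \<epsilon>"
        using dist_triangle[of z xbar "x k"] zt(2) \<eta>h N1[of k] k h(4) by (simp add: dist_norm)
      moreover have "- \<epsilon> * t \<le> G (z + t *\<^sub>R e) - G z"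
        using zt(3,5,6) \<epsilon> by (smt (verit) mult_pos_pos mult_minus_left)
      ultimately show ?thesis
        using zt \<eta>h h(4) \<epsilon> x_feasible[of k] by (intro exI[of _ z] exI[of _ t]) auto
    qed
  qed
qed

lemma limit_point_feasible:
  assumes "infinite K" "(x \<longlongrightarrow> xbar) (inf sequentially (principal K))"
  shows "xbar \<in> cbox l u"
proof (rule Lim_in_closed_set[OF closed_cbox _ _ assms(2)])
  show "inf sequentially (principal K) \<noteq> bot"
    using assms(1) unfolding trivial_limit_def eventually_inf_principal eventually_sequentially
      infinite_nat_iff_unbounded_le by auto
qed (simp add: x_feasible)

end

theorem theorem1:
  fixes l u :: "real ^ 'n"
    and F f :: "real ^ 'n \<Rightarrow> real ^ 'm \<Rightarrow> real"
    and Z :: "(real ^ 'm) set"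
    and y :: "real ^ 'n \<Rightarrow> real ^ 'm"
    and ytilde :: "real ^ 'n \<Rightarrow> real \<Rightarrow> real ^ 'm"
    and Fbar :: "real ^ 'n \<Rightarrow> real"
    and P :: "real ^ 'n \<Rightarrow> real \<Rightarrow> real"
    and L_F L_Fbar F_low \<gamma> \<delta> \<theta> \<sigma> \<zeta>bar :: real
    and d x :: "nat \<Rightarrow> real ^ 'n"
    and \<alpha>t \<zeta> :: "nat \<Rightarrow> real"
    and xbar :: "real ^ 'n"
    and K :: "nat set"
  assumes y_opt: "\<And>x. x \<in> cbox l u \<Longrightarrow> y x \<in> argmin_set (f x) Z"
    and ytilde: "\<And>x \<zeta>. x \<in> cbox l u \<Longrightarrow> \<zeta> > 0 \<Longrightarrow> norm (ytilde x \<zeta> - y x) \<le> \<zeta>"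
    and Fbar: "Fbar = (\<lambda>x. F x (y x))"
    and P: "P = (\<lambda>x \<zeta>. F x (ytilde x \<zeta>))"
    and F_lipschitz: "\<And>x. x \<in> cbox l u \<Longrightarrow> L_F-lipschitz_on UNIV (F x)"
    and Fbar_lipschitz: "L_Fbar-lipschitz_on (cbox l u) Fbar"
    and Fbar_low: "\<And>x. x \<in> cbox l u \<Longrightarrow> Fbar x \<ge> F_low"
    and "\<gamma> > 0" and "0 < \<delta>" "\<delta> < 1" and "0 < \<theta>" "\<theta> < 1" and "0 < \<sigma>" "\<sigma> < 1"
    and run: "dfn_lla_run l u P \<gamma> \<delta> \<theta> \<sigma> \<zeta>bar d x \<alpha>t \<zeta>"
    and "\<zeta> 0 > \<zeta>bar" and "\<zeta>bar = 0"
    and "infinite K"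
    and "(x \<longlongrightarrow> xbar) (inf sequentially (principal K))"
    and "dense_in_unit_sphere d K"
  shows "clarke_jahn_stationary l u Fbar xbar"
proof -
  have run0: "dfn_lla_run l u P \<gamma> \<delta> \<theta> \<sigma> 0 d x \<alpha>t \<zeta>" and \<zeta>0: "\<zeta> 0 > 0"
    using run \<open>\<zeta> 0 > \<zeta>bar\<close> \<open>\<zeta>bar = 0\<close> by auto
  have error: "\<bar>P w s - Fbar w\<bar> \<le> L_F * s" if w: "w \<in> cbox l u" and s: "s > 0" for w s
  proof -
    have "\<bar>P w s - Fbar w\<bar> \<le> L_F * norm (ytilde w s - y w)"
      using lipschitz_onD[OF F_lipschitz[OF w], of "ytilde w s" "y w"]
      by (simp add: P Fbar dist_norm)
    also have "\<dots> \<le> L_F * s"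
      using ytilde[OF w s] lipschitz_on_nonneg[OF F_lipschitz[OF w]] by (intro mult_left_mono)
    finally show ?thesis .
  qed
  have "L_F \<ge> 0"
    using run lipschitz_on_nonneg[OF F_lipschitz] by (auto simp: dfn_lla_run_def)
  then interpret inexact_dfn_lla l u P Fbar L_F F_low \<gamma> \<delta> \<theta> \<sigma> d x \<alpha>t \<zeta>
    using error Fbar_low run0 \<zeta>0 assms by unfold_locales auto
  have xbar: "xbar \<in> cbox l u"
    by (rule limit_point_feasible) fact+
  show ?thesis
    by (rule clarke_jahn_stationaryI[OF xbar], rule limit_point_ascent) (use assms xbar in auto)
qed

end
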